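(* Let $R$ be a commutative ring with unity, $P=\sum_\alpha c_\alpha\boldsymbol{x}^\alpha\in R[x_1,\dots,x_n]$, and let $(J_0,\dots,J_l,d_0,\dots,d_{l-1})$ be a complete Rado functional for $P$. Set $d_l=0$, $\overline{c}_i=\sum_{\alpha\in J_i}c_\alpha$ for $i\in\{0,\dots,l\}$, and $Q_{P,\mathcal{J}}(w)=\sum_{i=0}^{l}\overline{c}_i w^{d_i}$. Suppose that $S\subseteq R$ is infinite and closed under exponentiation, and that $Q_{P,\mathcal{J}}$ has a root in $S$. Then $P$ is partition regular over $S$, i.e. for every finite coloring $c$ of $S$ there are $c$-monochromatic $a_1,\dots,a_n\in S$ with $P(a_1,\dots,a_n)=0$.
   Context: $\operatorname{supp}(P)=\{\alpha\in\mathbb{N}_0^n:c_\alpha\ne0\}$. For $\alpha\in\mathbb{N}_0^n$, $\vec t\in\mathbb{N}^n$, $\alpha\cdot\vec t=\sum_j\alpha(j)t_j$. $\vec t$ is $c$-monochromatic for a coloring $c$ of $\mathbb{N}$ if all $t_j$ get the same color. A complete Rado functional for $P$ is a tuple $(J_0,\dots,J_l,d_0,\dots,d_{l-1})$, where $J_0,\dots,J_l$ is a partition of $\operatorname{supp}(P)$ into nonempty sets and $d_i\in\mathbb{N}$, such that for every finite coloring $c$ of $\mathbb{N}$ there are infinitely many $c$-monochromatic $\vec t\in\mathbb{N}^n$ for which there exist integers $M_0>M_1>\dots>M_l$ with $J_i=\{\alpha\in\operatorname{supp}(P):\alpha\cdot\vec t=M_i\}$ for all $i$ and $M_i-M_l=d_i$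 for all $i\in\{0,\dots,l-1\}$. A set $S\subseteq R$ is closed under exponentiation if $s^k\in S$ for all $s\in S$ and $k\in\mathbb{N}$. *)

theory Defs
  imports "HOL-Library.Poly_Mapping" "HOL-Library.Disjoint_Sets"
    "HOL-Computational_Algebra.Polynomial"
begin

text \<open>
  Exponents in \<open>\<nat>\<^sub>0\<^sup>n\<close> are finitely supported maps \<open>'n \<Rightarrow>\<^sub>0 nat\<close> and polynomials in
  \<open>R[x\<^sub>1,\<dots>,x\<^sub>n]\<close> are finitely supported maps from exponents to coefficients, where the finite type
  \<open>'n\<close> indexes the variables. Thus \<^const>\<open>Poly_Mapping.lookup\<close> \<open>P \<alpha>\<close> is the coefficient of \<open>P\<close> at \<open>\<alpha>\<close>, and
  \<^const>\<open>Poly_Mapping.keys\<close> \<open>P\<close> is the support of \<open>P\<close>. Throughout, \<open>\<nat>\<close> means the positive integers.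
\<close>

type_synonym ('n, 'a) mpolynomial = "('n \<Rightarrow>\<^sub>0 nat) \<Rightarrow>\<^sub>0 'a"

definition mpeval :: "('n::finite, 'a::comm_ring_1) mpolynomial \<Rightarrow> ('n \<Rightarrow> 'a) \<Rightarrow> 'a" where
  "mpeval P a = (\<Sum>\<alpha>\<in>Poly_Mapping.keys P. Poly_Mapping.lookup P \<alpha> * (\<Prod>j\<in>UNIV. a j ^ Poly_Mapping.lookup \<alpha> j))"

definition exp_dot :: "('n::finite \<Rightarrow>\<^sub>0 nat) \<Rightarrow> ('n \<Rightarrow> nat) \<Rightarrow> nat" where
  "exp_dot \<alpha> t = (\<Sum>j\<in>UNIV. Poly_Mapping.lookup \<alpha> j * t j)"

text \<open>Colors are natural numbers; a coloring of \<open>X\<close> is finite if it uses finitely many of them on \<open>X\<close>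
  (its values outside \<open>X\<close> are irrelevant).\<close>

definition finite_coloring :: "'x set \<Rightarrow> ('x \<Rightarrow> nat) \<Rightarrow> bool" where
  "finite_coloring X c \<longleftrightarrow> finite (c ` X)"

definition monochromatic :: "('x \<Rightarrow> nat) \<Rightarrow> ('n \<Rightarrow> 'x) \<Rightarrow> bool" where
  "monochromatic c t \<longleftrightarrow> (\<exists>k. \<forall>j. c (t j) = k)"

text \<open>The tuple \<open>(J\<^sub>0,\<dots>,J\<^sub>l,d\<^sub>0,\<dots>,d\<^sub>l\<^sub>-\<^sub>1)\<close> is given by \<open>l\<close> and two sequences, of which only
  \<open>J i\<close> for \<open>i \<le> l\<close> and \<open>d i\<close> for \<open>i < l\<close> matter.\<close>

definition complete_Rado_functional ::
  "('n::finite, 'a::comm_ring_1) mpolynomial \<Rightarrow> nat \<Rightarrow> (nat \<Rightarrow> ('n \<Rightarrow>\<^sub>0 nat) set) \<Rightarrow> (nat \<Rightarrow> nat) \<Rightarrow> bool"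
where
  "complete_Rado_functional P l J d \<longleftrightarrow>
     (\<Union>i\<le>l. J i) = Poly_Mapping.keys P \<and> disjoint_family_on J {..l} \<and> (\<forall>i\<le>l. J i \<noteq> {}) \<and>
     (\<forall>i<l. d i \<ge> 1) \<and>
     (\<forall>c. finite_coloring {1..} c \<longrightarrow>
        infinite {t :: 'n \<Rightarrow> nat. (\<forall>j. t j \<ge> 1) \<and> monochromatic c t \<and>
          (\<exists>M :: nat \<Rightarrow> int.
             (\<forall>i j. i < j \<and> j \<le> l \<longrightarrow> M i > M j) \<and>
             (\<forall>i\<le>l. J i = {\<alpha> \<in> Poly_Mapping.keys P. int (exp_dot \<alpha> t) = M i}) \<and>
             (\<forall>i<l. M i - M l = int (d i)))})"

text \<open>The update \<open>d(l := 0)\<close> implements the convention \<open>d\<^sub>l = 0\<close>.\<close>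

definition Rado_poly ::
  "('n::finite, 'a::comm_ring_1) mpolynomial \<Rightarrow> nat \<Rightarrow> (nat \<Rightarrow> ('n \<Rightarrow>\<^sub>0 nat) set) \<Rightarrow> (nat \<Rightarrow> nat) \<Rightarrow> 'a poly"
where
  "Rado_poly P l J d = (\<Sum>i\<le>l. monom (\<Sum>\<alpha>\<in>J i. Poly_Mapping.lookup P \<alpha>) ((d(l := 0)) i))"

definition closed_under_exponentiation :: "'a::comm_ring_1 set \<Rightarrow> bool" where
  "closed_under_exponentiation S \<longleftrightarrow> (\<forall>s\<in>S. \<forall>k\<ge>1. s ^ k \<in> S)"

definition partition_regular_over :: "('n::finite, 'a::comm_ring_1) mpolynomial \<Rightarrow> 'a set \<Rightarrow> bool" where
  "partition_regular_over P S \<longleftrightarrow>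
     (\<forall>c. finite_coloring S c \<longrightarrow>
        (\<exists>a :: 'n \<Rightarrow> 'a. (\<forall>j. a j \<in> S) \<and> monochromatic c a \<and> mpeval P a = 0))"

end

theory Submission
  imports Defs
begin

text \<open>
  Let \<open>w \<in> S\<close> be a root of the Rado polynomial, and color \<open>k \<in> \<nat>\<close> by the color of \<open>w ^ k\<close>. A tuple
  \<open>t\<close> provided by the Rado functional for this coloring gives the monochromatic point
  \<open>a j = w ^ t j\<close>. All monomials with exponent in \<open>J i\<close> take the value \<open>w ^ (M l + d i)\<close> at \<open>a\<close>, so
  \<open>P\<close> evaluates to \<open>w ^ M l\<close> times the value of the Rado polynomial at \<open>w\<close>.
\<close>

lemma prod_power_exp_dot:
  fixes w :: "'a::comm_ring_1"
  shows "(\<Prod>j\<in>UNIV. (w ^ t j) ^ Poly_Mapping.lookup \<alpha> j) = w ^ exp_dot \<alpha> t"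
  by (simp add: exp_dot_def power_sum power_mult [symmetric] mult.commute)

text \<open>Substituting powers of \<open>w\<close> turns each monomial into a single power of
  \<open>w\<close> whose exponent depends only on the class \<open>J i\<close>. Summing class by
  class therefore collects the coefficients of the Rado polynomial, and the common offset
  \<open>m\<close> factors out.\<close>

lemma mpeval_powers_eq_Rado_poly:
  fixes P :: "('n::finite, 'a::comm_ring_1) mpolynomial"
  assumes cover: "(\<Union>i\<le>l. J i) = Poly_Mapping.keys P"
    and disj: "disjoint_family_on J {..l}"
    and exps: "\<And>i \<alpha>. i \<le> l \<Longrightarrow> \<alpha> \<in> J i \<Longrightarrow> exp_dot \<alpha> t = m + (d(l := 0)) i"
  shows "mpeval P (\<lambda>j. w ^ t j) = w ^ m * poly (Rado_poly P l J d) w"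
proof -
  have fin: "finite (J i)" if "i \<le> l" for i
    using that cover by (intro finite_subset [OF _ finite_keys [of P]]) blast
  have "mpeval P (\<lambda>j. w ^ t j) = (\<Sum>\<alpha>\<in>(\<Union>i\<le>l. J i). Poly_Mapping.lookup P \<alpha> * w ^ exp_dot \<alpha> t)"
    by (simp add: mpeval_def prod_power_exp_dot cover)
  also have "\<dots> = (\<Sum>i\<le>l. \<Sum>\<alpha>\<in>J i. Poly_Mapping.lookup P \<alpha> * w ^ exp_dot \<alpha> t)"
    using fin disj by (intro sum.UNION_disjoint) (auto simp: disjoint_family_on_def)
  also have "\<dots> = (\<Sum>i\<le>l. \<Sum>\<alpha>\<in>J i. w ^ m * (Poly_Mapping.lookup P \<alpha> * w ^ (d(l := 0)) i))"
    using exps by (intro sum.cong refl) (simp add: power_add algebra_simps)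
  also have "\<dots> = w ^ m * poly (Rado_poly P l J d) w"
    by (simp only: Rado_poly_def poly_sum poly_monom sum_distrib_left sum_distrib_right)
  finally show ?thesis .
qed

text \<open>Replaces the integer levels \<open>M i\<close> by \<open>m + d i\<close> with
  \<open>m\<close> natural, so that \<open>w ^ m\<close> makes sense in a ring where
  \<open>w\<close> need not be invertible.\<close>

lemma complete_Rado_functional_exponents:
  fixes P :: "('n::finite, 'a::comm_ring_1) mpolynomial"
  assumes rado: "complete_Rado_functional P l J d" and col: "finite_coloring {1..} c"
  obtains t m where "\<And>j. t j \<ge> 1" "monochromatic c t"
    "\<And>i \<alpha>. i \<le> l \<Longrightarrow> \<alpha> \<in> J i \<Longrightarrow> exp_dot \<alpha> t = m + (d(l := 0)) i"
proof -
  let ?T = "{t :: 'n \<Rightarrow> nat. (\<forall>j. t j \<ge> 1) \<and> monochromatic c t \<and>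
    (\<exists>M :: nat \<Rightarrow> int. (\<forall>i j. i < j \<and> j \<le> l \<longrightarrow> M i > M j) \<and>
      (\<forall>i\<le>l. J i = {\<alpha> \<in> Poly_Mapping.keys P. int (exp_dot \<alpha> t) = M i}) \<and>
      (\<forall>i<l. M i - M l = int (d i)))}"
  have "infinite ?T"
    using rado col unfolding complete_Rado_functional_def by simp
  then have "?T \<noteq> {}"
    by (rule infinite_imp_nonempty)
  then obtain t :: "'n \<Rightarrow> nat" and M :: "nat \<Rightarrow> int"
    where t: "\<And>j. t j \<ge> 1" "monochromatic c t"
      and M: "\<forall>i\<le>l. J i = {\<alpha> \<in> Poly_Mapping.keys P. int (exp_dot \<alpha> t) = M i}"
      and diff: "\<forall>i<l. M i - M l = int (d i)"
    by auto
  have M_eq: "int (exp_dot \<alpha> t) = M i" if "i \<le> l" "\<alpha> \<in> J i" for i \<alpha>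
    using M that by blast
  have "J l \<noteq> {}"
    using rado by (simp add: complete_Rado_functional_def)
  \<comment> \<open>An element of the lowest class realizes \<open>M l\<close> as the natural number
    \<open>exp_dot \<beta> t\<close>, which serves as \<open>m\<close>.\<close>
  then obtain \<beta> where "\<beta> \<in> J l" by blast
  then have \<beta>: "int (exp_dot \<beta> t) = M l" by (simp add: M_eq)
  have "exp_dot \<alpha> t = exp_dot \<beta> t + (d(l := 0)) i" if "i \<le> l" "\<alpha> \<in> J i" for i \<alpha>
  \<comment> \<open>The differences are prescribed only for \<open>i < l\<close>; at
    \<open>i = l\<close> the update supplies the offset 0, whatever the value of
    \<open>d l\<close>.\<close>
  proof (cases "i = l")
    case True
    then show ?thesis using M_eq [OF that] \<beta> by simp
  next
    case False
    with that diff have "M i - M l = int (d i)" by simp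
    with False show ?thesis using M_eq [OF that] \<beta> by simp
  qed
  with t show thesis by (rule that)
qed

theorem theorem3p4:
  fixes P :: "('n::finite, 'a::comm_ring_1) mpolynomial"
    and l :: nat
    and J :: "nat \<Rightarrow> ('n \<Rightarrow>\<^sub>0 nat) set"
    and d :: "nat \<Rightarrow> nat"
    and S :: "'a set"
  assumes "complete_Rado_functional P l J d"
    and "infinite S"
    and "closed_under_exponentiation S"
    and "\<exists>w\<in>S. poly (Rado_poly P l J d) w = 0"
  shows "partition_regular_over P S"
  unfolding partition_regular_over_def
proof (intro allI impI)
  fix c :: "'a \<Rightarrow> nat"
  assume c: "finite_coloring S c"
  obtain w where w: "w \<in> S" "poly (Rado_poly P l J d) w = 0"
    using assms(4) by blast
  \<comment> \<open>The exponent 0 is excluded because 1 may lie outside \<open>S\<close>; this is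
    why positivity of the \<open>t j\<close> matters below.\<close>
  have pow: "w ^ k \<in> S" if "k \<ge> 1" for k
    using assms(3) w(1) that by (simp add: closed_under_exponentiation_def)
  \<comment> \<open>The pulled-back coloring uses only colors that \<open>c\<close> takes on
    \<open>S\<close>, hence finitely many.\<close>
  have "(\<lambda>k. c (w ^ k)) ` {1..} \<subseteq> c ` S"
    using pow by auto
  with c have "finite_coloring {1..} (\<lambda>k. c (w ^ k))"
    unfolding finite_coloring_def by (rule finite_subset [rotated])
  with assms(1) obtain t m where t: "\<And>j. t j \<ge> 1" "monochromatic (\<lambda>k. c (w ^ k)) t"
    and exps: "\<And>i \<alpha>. i \<le> l \<Longrightarrow> \<alpha> \<in> J i \<Longrightarrow> exp_dot \<alpha> t = m + (d(l := 0)) i"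
    by (rule complete_Rado_functional_exponents) blast
  have "mpeval P (\<lambda>j. w ^ t j) = w ^ m * poly (Rado_poly P l J d) w"
    using assms(1) exps
    by (intro mpeval_powers_eq_Rado_poly) (auto simp: complete_Rado_functional_def)
  then have "mpeval P (\<lambda>j. w ^ t j) = 0"
    using w(2) by simp
  moreover have "\<forall>j. w ^ t j \<in> S"
    using t(1) pow by blast
  moreover have "monochromatic c (\<lambda>j. w ^ t j)"
    using t(2) by (simp add: monochromatic_def)
  ultimately show "\<exists>a. (\<forall>j. a j \<in> S) \<and> monochromatic c a \<and> mpeval P a = 0"
    by (intro exI [of _ "\<lambda>j. w ^ t j"] conjI)
qed

end
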